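(* Let $Z=(Z_n)_{n\ge 0}$ be a branching random walk on $\mathbb{R}$ whose reproduction law satisfies Assumptions (A1)–(A4) but not (A5) (all stated in the context). Then for all $x>0$ and $n\ge1$, $$\mathbb{P}\Big(\bar{Z}_n\big([-\sqrt{n}\,x,\sqrt{n}\,x]^c\big) > 2e^{-x^2/(2r_0^2)}\Big)=0.$$
   Context: Notation. For a Borel measure $\zeta$ on $\mathbb{R}$, $|\zeta| := \zeta(\mathbb{R})$, $\langle \zeta, f\rangle := \int f\,d\zeta$ (so $\langle\zeta,x\rangle=\int x\,\zeta(dx)$, $\langle \zeta,x^2\rangle=\int x^2\,\zeta(dx)$), and $\bar\zeta := \zeta/|\zeta|$. For a finite point measure $\zeta$, $(x : x\in\zeta)$ lists its atoms, each atom $x$ repeated $\zeta(\{x\})$ times, repetitions counting as different indices. For $B\subseteq\mathbb{R}$, $B^c=\mathbb{R}\setminus B$. Branching random walk. $Z=(Z_n)_{n\ge0}$ is a sequence of random point measures on $\mathbb{R}$ with $Z_0=\delta_0$, $Z_1$ distributed according to a given reproduction law, and, for $n\ge2$, conditionally on $Z_0,\dots,Z_{n-1}$, $Z_n$ is distributed as $\sum_{x\in Z_{n-1}} Z_1^{(x)}(\cdot - x)$, where the $Z_1^{(x)}$, $x\in Z_{n-1}$, are independent copies of $Z_1$. Assumptions on the reproduction law: (A1) $\mathbb{E}\,|Z_1|\log|Z_1|<\infty$. (A2) $\mathbb{E}\langle Z_1,x\rangle=0$ and $\mathbb{E}\langle Z_1,x^2\rangle/\mathbb{E}|Z_1|=1$.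 (A3) $\log 2\le b_0 := \operatorname{ess\,inf}(\log|Z_1|)\le \operatorname{ess\,sup}(\log|Z_1|)=:b_1\le\infty$. (A4) There exist $r_0<\infty$ and a discrete subset $\mathcal{R}\subseteq[-r_0,r_0]$ such that $\operatorname{supp}(Z_1)\subseteq\mathcal{R}$ almost surely. (A5) $\operatorname{Var}(|Z_1|)+\operatorname{Var}(\langle Z_1,x\rangle)>0$. *)

theory Defs
  imports "HOL-Probability.Probability"
begin

section \<open>Finite point measures\<close>

text \<open>
  A finite point measure on the real line is represented by the finite multiset of its atoms.
  \<open>atoms \<zeta>\<close> lists the atoms, repetitions counting as different indices, and \<open>pm \<zeta>\<close> is the
  Borel measure itself, i.e. the sum of the Dirac measures at the listed atoms.
\<close>

definition atoms :: "real multiset \<Rightarrow> (real \<times> nat) set" where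
  "atoms \<zeta> = {(x, i). i < count \<zeta> x}"

definition pm :: "real multiset \<Rightarrow> real measure" where
  "pm \<zeta> = distr (count_space (atoms \<zeta>)) borel fst"

definition mass :: "real measure \<Rightarrow> real" where
  "mass \<zeta> = measure \<zeta> UNIV"

definition pairing :: "real measure \<Rightarrow> (real \<Rightarrow> real) \<Rightarrow> real" where
  "pairing \<zeta> f = (\<integral>x. f x \<partial>\<zeta>)"

definition normalised :: "real measure \<Rightarrow> real measure" where
  "normalised \<zeta> = scale_measure (1 / emeasure \<zeta> UNIV) \<zeta>"

definition msupport :: "real measure \<Rightarrow> real set" where
  "msupport \<zeta> = {x. \<forall>U. open U \<and> x \<in> U \<longrightarrow> emeasure \<zeta> U > 0}"

text \<open>
  The space of finite point measures carries the usual \<open>\<sigma>\<close>-algebra, generated by the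
  evaluations at Borel sets.
\<close>

definition pm_space :: "real multiset measure" where
  "pm_space = (SUP B \<in> sets (borel :: real measure).
     vimage_algebra UNIV (\<lambda>\<zeta>. emeasure (pm \<zeta>) B) borel)"

section \<open>Branching random walks\<close>

text \<open>
  \<open>offspring_law \<mu> \<zeta>\<close> is the law of the sum, over the listed atoms \<open>x\<close> of \<open>\<zeta>\<close>, of
  independent point measures of law \<open>\<mu>\<close> shifted by \<open>x\<close>.
\<close>

definition superpose :: "real multiset \<Rightarrow> (real \<times> nat \<Rightarrow> real multiset) \<Rightarrow> real multiset" where
  "superpose \<zeta> \<omega> = (\<Sum>p\<in>atoms \<zeta>. image_mset (\<lambda>y. y + fst p) (\<omega> p))"

definition offspring_law :: "real multiset measure \<Rightarrow> real multiset \<Rightarrow> real multiset measure" where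
  "offspring_law \<mu> \<zeta> = distr (\<Pi>\<^sub>M p\<in>atoms \<zeta>. \<mu>) pm_space (superpose \<zeta>)"

text \<open>The \<open>\<sigma>\<close>-algebra generated by \<open>Z 0, \<dots>, Z (n - 1)\<close> (used for \<open>n > 0\<close> only).\<close>

definition history :: "'a measure \<Rightarrow> (nat \<Rightarrow> 'a \<Rightarrow> real multiset) \<Rightarrow> nat \<Rightarrow> 'a measure" where
  "history M Z n = (SUP i\<in>{..<n}. vimage_algebra (space M) (Z i) pm_space)"

locale branching_random_walk = prob_space M
  for M :: "'a measure" and \<mu> :: "real multiset measure" and Z :: "nat \<Rightarrow> 'a \<Rightarrow> real multiset" +
  assumes random_point_measure: "\<And>n. Z n \<in> measurable M pm_space"
    and start: "\<And>\<omega>. \<omega> \<in> space M \<Longrightarrow> Z 0 \<omega> = {#0#}"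
    and reproduction_law: "\<mu> = distr M pm_space (Z 1)"
    and branching: "\<And>n A. n \<ge> 2 \<Longrightarrow> A \<in> sets pm_space \<Longrightarrow>
      AE \<omega> in M. real_cond_exp M (history M Z n) (indicator {\<omega> \<in> space M. Z n \<omega> \<in> A}) \<omega>
        = measure (offspring_law \<mu> (Z (n - 1) \<omega>)) A"

section \<open>Assumptions on the reproduction law\<close>

text \<open>
  In what follows the identity on \<^const>\<open>pm_space\<close> under \<open>\<mu>\<close> plays the role of the first
  generation of the walk.
\<close>

definition elog :: "real \<Rightarrow> ereal" where
  "elog t = (if t = 0 then -\<infinity> else ereal (ln t))"

definition essinf :: "'a measure \<Rightarrow> ('a \<Rightarrow> ereal) \<Rightarrow> ereal" where
  "essinf M f = - esssup M (\<lambda>x. - f x)"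

text \<open>
  The variance takes values in \<open>[0, \<infinity>]\<close>; the library's \<open>variance\<close> would be 0 for an integrable
  variable that is not square integrable.
\<close>

definition ext_variance :: "'a measure \<Rightarrow> ('a \<Rightarrow> real) \<Rightarrow> ennreal" where
  "ext_variance M X = (\<integral>\<^sup>+\<omega>. ennreal ((X \<omega> - (\<integral>\<omega>'. X \<omega>' \<partial>M))\<^sup>2) \<partial>M)"

definition A1 :: "real multiset measure \<Rightarrow> bool" where
  "A1 \<mu> \<longleftrightarrow> (\<integral>\<^sup>+\<zeta>. ennreal (mass (pm \<zeta>) * ln (mass (pm \<zeta>))) \<partial>\<mu>) < \<infinity>"

text \<open>
  The mean of \<open>\<langle>Z\<^sub>1, x\<rangle>\<close> is required to exist, since a Bochner integral that does not exist is 0.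
  The quotient being 1 forces the existence of the other two means.
\<close>

definition A2 :: "real multiset measure \<Rightarrow> bool" where
  "A2 \<mu> \<longleftrightarrow>
     integrable \<mu> (\<lambda>\<zeta>. pairing (pm \<zeta>) (\<lambda>x. x)) \<and>
     (\<integral>\<zeta>. pairing (pm \<zeta>) (\<lambda>x. x) \<partial>\<mu>) = 0 \<and>
     (\<integral>\<zeta>. pairing (pm \<zeta>) (\<lambda>x. x\<^sup>2) \<partial>\<mu>) / (\<integral>\<zeta>. mass (pm \<zeta>) \<partial>\<mu>) = 1"

definition A3 :: "real multiset measure \<Rightarrow> bool" where
  "A3 \<mu> \<longleftrightarrow>
     (let b0 = essinf \<mu> (\<lambda>\<zeta>. elog (mass (pm \<zeta>)));
          b1 = esssup \<mu> (\<lambda>\<zeta>. elog (mass (pm \<zeta>)))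
      in ereal (ln 2) \<le> b0 \<and> b0 \<le> b1 \<and> b1 \<le> \<infinity>)"

definition A4 :: "real multiset measure \<Rightarrow> real \<Rightarrow> bool" where
  "A4 \<mu> r0 \<longleftrightarrow>
     (\<exists>R. R \<subseteq> {-r0..r0} \<and> topological_space_class.discrete R \<and> (AE \<zeta> in \<mu>. msupport (pm \<zeta>) \<subseteq> R))"

definition A5 :: "real multiset measure \<Rightarrow> bool" where
  "A5 \<mu> \<longleftrightarrow>
     ext_variance \<mu> (\<lambda>\<zeta>. mass (pm \<zeta>))
       + ext_variance \<mu> (\<lambda>\<zeta>. pairing (pm \<zeta>) (\<lambda>x. x)) > 0"

end

theory Submission
  imports Defs
begin

text \<open>
  If (A5) fails, every particle has the same number \<open>c\<close> of children and their displacements sum to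
  zero. As the displacements lie in \<open>[-r\<^sub>0, r\<^sub>0]\<close>, Hoeffding's lemma bounds the exponential moment
  \<open>\<langle>Z\<^sub>1, exp (s x)\<rangle>\<close> almost surely, not only on average, by \<open>c exp (s\<^sup>2 r\<^sub>0\<^sup>2 / 2)\<close>. This bound is
  multiplicative over the generations, so the claim is the Chernoff bound for the
  empirical measure of \<open>Z\<^sub>n\<close>.
\<close>

section \<open>Finite point measures as multisets\<close>

text \<open>Copies of \<open>x\<close> are numbered from 0, so the new copy receives the number
  \<open>count \<zeta> x\<close>. This makes induction along the multiset possible.\<close>

lemma atoms_add_mset: "atoms (add_mset x \<zeta>) = insert (x, count \<zeta> x) (atoms \<zeta>)"
  by (auto simp: atoms_def less_Suc_eq split: if_splits)

lemma atoms_notin: "(x, count \<zeta> x) \<notin> atoms \<zeta>"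
  by (simp add: atoms_def)

lemma finite_atoms [simp]: "finite (atoms \<zeta>)"
  by (induction \<zeta>) (simp_all add: atoms_add_mset, simp add: atoms_def)

lemma sum_atoms:
  fixes f :: "real \<Rightarrow> 'b::comm_monoid_add"
  shows "(\<Sum>p\<in>atoms \<zeta>. f (fst p)) = (\<Sum>x\<in>#\<zeta>. f x)"
proof (induction \<zeta>)
  case empty
  show ?case by (simp add: atoms_def)
next
  case (add x \<zeta>)
  then show ?case by (simp add: atoms_add_mset atoms_notin)
qed

lemma sets_pm [simp, measurable_cong]: "sets (pm \<zeta>) = sets borel"
  by (simp add: pm_def)

lemma space_pm [simp]: "space (pm \<zeta>) = UNIV"
  by (simp add: pm_def)

lemma nn_integral_pm:
  assumes "f \<in> borel_measurable borel"
  shows "(\<integral>\<^sup>+x. f x \<partial>pm \<zeta>) = (\<Sum>x\<in>#\<zeta>. f x)"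
  using assms by (simp add: pm_def nn_integral_distr nn_integral_count_space_finite sum_atoms)

lemma emeasure_pm: "B \<in> sets borel \<Longrightarrow> emeasure (pm \<zeta>) B = (\<Sum>x\<in>#\<zeta>. indicator B x)"
  using nn_integral_pm[of "indicator B" \<zeta>] by simp

lemma sum_mset_nonneg:
  fixes f :: "'b \<Rightarrow> 'c::ordered_comm_monoid_add"
  shows "(\<And>x. x \<in># A \<Longrightarrow> 0 \<le> f x) \<Longrightarrow> 0 \<le> (\<Sum>x\<in>#A. f x)"
  by (induction A) auto

lemma ennreal_sum_mset:
  "(\<And>x. x \<in># A \<Longrightarrow> 0 \<le> f x) \<Longrightarrow> (\<Sum>x\<in>#A. ennreal (f x)) = ennreal (\<Sum>x\<in>#A. f x)"
proof (induction A)
  case (add x A)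
  have "0 \<le> (\<Sum>x\<in>#A. f x)"
    using add.prems by (intro sum_mset_nonneg) auto
  with add show ?case by (simp add: ennreal_plus)
qed simp

lemma measure_pm:
  assumes "B \<in> sets borel"
  shows "measure (pm \<zeta>) B = (\<Sum>x\<in>#\<zeta>. indicator B x)"
proof -
  have "emeasure (pm \<zeta>) B = ennreal (\<Sum>x\<in>#\<zeta>. indicator B x)"
    by (subst ennreal_sum_mset[symmetric]) (simp_all add: emeasure_pm assms ennreal_indicator)
  then show ?thesis
    by (simp add: measure_def sum_mset_nonneg)
qed

lemma emeasure_pm_UNIV: "emeasure (pm \<zeta>) UNIV = ennreal (size \<zeta>)"
  by (simp add: emeasure_pm ennreal_of_nat_eq_real_of_nat)

lemma mass_pm: "mass (pm \<zeta>) = size \<zeta>"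
  by (simp add: mass_def measure_pm)

lemma pairing_pm:
  assumes "f \<in> borel_measurable borel"
  shows "pairing (pm \<zeta>) f = (\<Sum>x\<in>#\<zeta>. f x)"
  using assms
  by (simp add: pairing_def pm_def integral_distr lebesgue_integral_count_space_finite sum_atoms)

text \<open>Every open neighbourhood of an atom has mass at least 1. This turns the support
  condition in \<open>A4\<close> into a bound on the atoms themselves.\<close>

lemma set_mset_subset_msupport: "set_mset \<zeta> \<subseteq> msupport (pm \<zeta>)"
proof
  fix x assume "x \<in># \<zeta>"
  then obtain \<xi> where \<zeta>: "\<zeta> = add_mset x \<xi>"
    by (metis insert_DiffM)
  show "x \<in> msupport (pm \<zeta>)"
    by (auto simp: msupport_def emeasure_pm \<zeta> intro: less_le_trans[OF zero_less_one])
qed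

lemma measure_normalised_pm:
  assumes "B \<in> sets borel"
  shows "measure (normalised (pm \<zeta>)) B = (\<Sum>x\<in>#\<zeta>. indicator B x) / size \<zeta>"
proof (cases "\<zeta> = {#}")
  \<comment> \<open>Here the scaling factor is 1 / 0 = \<infinity>, but it multiplies the zero
    measure; the right-hand side is 0 / 0 = 0.\<close>
  case True
  then show ?thesis
    using assms by (simp add: normalised_def measure_def emeasure_pm)
next
  case False
  then have "1 / emeasure (pm \<zeta>) UNIV = ennreal (1 / size \<zeta>)"
    by (simp add: emeasure_pm_UNIV divide_ennreal nonempty_has_size flip: ennreal_1)
  then show ?thesis
    using assms by (simp add: normalised_def measure_pm)
qed

text \<open>Additive functionals of a generation split into the contributions of the parents. It is
  applied to the constant 1, to exponentials and to indicators.\<close>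

lemma sum_mset_superpose:
  fixes f :: "real \<Rightarrow> 'b::comm_monoid_add"
  shows "(\<Sum>x\<in>#superpose \<zeta> \<eta>. f x) = (\<Sum>p\<in>atoms \<zeta>. \<Sum>y\<in>#\<eta> p. f (y + fst p))"
proof -
  have "(\<Sum>x\<in>#(\<Sum>p\<in>A. g p). f x) = (\<Sum>p\<in>A. \<Sum>x\<in>#g p. f x)" if "finite A"
    for A and g :: "real \<times> nat \<Rightarrow> real multiset"
    using that by induction auto
  then show ?thesis
    by (simp add: superpose_def image_mset.compositionality comp_def)
qed

section \<open>Measurability\<close>

lemma space_pm_space [simp]: "space pm_space = UNIV"
  by (auto simp: pm_space_def space_Sup_eq_UN)

lemma measurable_emeasure_pm:
  "B \<in> sets borel \<Longrightarrow> (\<lambda>\<zeta>. emeasure (pm \<zeta>) B) \<in> borel_measurable pm_space"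
  unfolding pm_space_def by (rule measurable_SUP1) (auto intro: measurable_vimage_algebra1)

text \<open>The generators of \<open>pm_space\<close> are the integrals of indicators; linearity and
  monotone limits extend measurability to all nonnegative integrands.\<close>

lemma measurable_nn_integral_pm:
  fixes f :: "real \<Rightarrow> ennreal"
  assumes "f \<in> borel_measurable borel"
  shows "(\<lambda>\<zeta>. \<integral>\<^sup>+x. f x \<partial>pm \<zeta>) \<in> borel_measurable pm_space"
  using assms
proof induct
  case (cong f g)
  then show ?case by simp
next
  case (set B)
  then show ?case by (simp add: measurable_emeasure_pm)
next
  case (mult f c)
  then show ?case by (simp add: nn_integral_cmult)
next
  case (add f g)
  then show ?case by (simp add: nn_integral_add)
next
  case (seq F)
  have "(\<lambda>\<zeta>. \<integral>\<^sup>+x. (SUP i. F i) x \<partial>pm \<zeta>) = (\<lambda>\<zeta>. SUP i. \<integral>\<^sup>+x. F i x \<partial>pm \<zeta>)"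
    unfolding SUP_apply
    using seq by (intro ext nn_integral_monotone_convergence_SUP) auto
  with seq show ?case by simp
qed

text \<open>Nonnegativity lets the real sum be recovered from an extended integral, which is
  finite.\<close>

lemma measurable_sum_mset_pm_space:
  assumes "f \<in> borel_measurable borel" and "\<And>x. 0 \<le> f x"
  shows "(\<lambda>\<zeta>. \<Sum>x\<in>#\<zeta>. f x :: real) \<in> borel_measurable pm_space"
proof -
  have "(\<lambda>\<zeta>. \<integral>\<^sup>+x. ennreal (f x) \<partial>pm \<zeta>) \<in> borel_measurable pm_space"
    using assms by (intro measurable_nn_integral_pm) measurable
  then have "(\<lambda>\<zeta>. enn2real (\<integral>\<^sup>+x. ennreal (f x) \<partial>pm \<zeta>)) \<in> borel_measurable pm_space"
    by measurable
  also have "(\<lambda>\<zeta>. enn2real (\<integral>\<^sup>+x. ennreal (f x) \<partial>pm \<zeta>)) = (\<lambda>\<zeta>. \<Sum>x\<in>#\<zeta>. f x)"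
    using assms by (simp add: nn_integral_pm ennreal_sum_mset sum_mset_nonneg)
  finally show ?thesis .
qed

lemma measurable_size_pm_space: "(\<lambda>\<zeta>. real (size \<zeta>)) \<in> borel_measurable pm_space"
  using measurable_sum_mset_pm_space[of "\<lambda>_. 1"] by simp

text \<open>It suffices to test evaluations at Borel sets. Moving the shift into the integrand
  writes each as a finite sum of terms that depend on one coordinate only.\<close>

lemma measurable_superpose:
  assumes "sets \<mu> = sets pm_space"
  shows "superpose \<zeta> \<in> measurable (\<Pi>\<^sub>M p\<in>atoms \<zeta>. \<mu>) pm_space"
  unfolding pm_space_def
proof (rule measurable_SUP2)
  fix B :: "real set" assume [measurable]: "B \<in> sets borel"
  have 1: "(\<lambda>\<eta>. \<integral>\<^sup>+y. indicator B (y + fst p) \<partial>pm (\<eta> p))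
      \<in> borel_measurable (\<Pi>\<^sub>M p\<in>atoms \<zeta>. \<mu>)" if "p \<in> atoms \<zeta>" for p
  proof (rule measurable_compose[OF measurable_component_singleton[OF that]])
    show "(\<lambda>\<xi>. \<integral>\<^sup>+y. indicator B (y + fst p) \<partial>pm \<xi>) \<in> borel_measurable \<mu>"
      unfolding measurable_cong_sets[OF assms refl]
      by (intro measurable_nn_integral_pm) measurable
  qed
  have "(\<lambda>\<eta>. emeasure (pm (superpose \<zeta> \<eta>)) B)
      = (\<lambda>\<eta>. \<Sum>p\<in>atoms \<zeta>. \<integral>\<^sup>+y. indicator B (y + fst p) \<partial>pm (\<eta> p))"
  proof
    fix \<eta>
    have "(\<integral>\<^sup>+y. indicator B (y + a) \<partial>pm \<xi>) = (\<Sum>y\<in>#\<xi>. indicator B (y + a))" for \<xi> a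
      by (intro nn_integral_pm) measurable
    then show "emeasure (pm (superpose \<zeta> \<eta>)) B
        = (\<Sum>p\<in>atoms \<zeta>. \<integral>\<^sup>+y. indicator B (y + fst p) \<partial>pm (\<eta> p))"
      using \<open>B \<in> sets borel\<close> by (simp add: emeasure_pm sum_mset_superpose)
  qed
  with 1 show "superpose \<zeta> \<in> measurable (\<Pi>\<^sub>M p\<in>atoms \<zeta>. \<mu>)
      (vimage_algebra UNIV (\<lambda>\<zeta>. emeasure (pm \<zeta>) B) borel)"
    by (intro measurable_vimage_algebra2) (auto intro!: borel_measurable_sum)
qed auto

section \<open>Almost sure bounds along the generations\<close>

context branching_random_walk
begin

lemma prob_space_reproduction_law: "prob_space \<mu>"
  unfolding reproduction_law by (rule prob_space_distr[OF random_point_measure])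

lemma sets_reproduction_law: "sets \<mu> = sets pm_space"
  by (simp add: reproduction_law)

text \<open>For \<open>n = 0\<close> the supremum is empty and so is its space, hence the
  restriction to positive \<open>n\<close>.\<close>

lemma subalgebra_history:
  assumes "0 < n"
  shows "subalgebra M (history M Z n)"
proof -
  have "sets (history M Z n) \<subseteq> sets M"
    unfolding history_def using assms random_point_measure
    by (intro sets_Sup_in_sets) (auto dest!: sets_image_in_sets[OF refl, THEN subsetD, rotated])
  moreover have "space (history M Z n) = space M"
    using assms by (auto simp: history_def space_Sup_eq_UN)
  ultimately show ?thesis by (simp add: subalgebra_def)
qed

text \<open>The conditional probability of \<open>Z n \<omega> \<in> B\<close> given the history is
  almost surely 1, and its expectation is the unconditional probability. Thus statements about
  independent copies of the first generation carry over to the walk.\<close>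

lemma AE_next_generation:
  assumes n: "n \<ge> 2" and B: "B \<in> sets pm_space"
    and prev: "AE \<omega> in M. Z (n - 1) \<omega> \<in> A"
    and step: "\<And>\<zeta>. \<zeta> \<in> A \<Longrightarrow> AE \<eta> in (\<Pi>\<^sub>M p\<in>atoms \<zeta>. \<mu>). superpose \<zeta> \<eta> \<in> B"
  shows "AE \<omega> in M. Z n \<omega> \<in> B"
proof -
  let ?E = "{\<omega> \<in> space M. Z n \<omega> \<in> B}"
  have E: "?E \<in> sets M"
    using measurable_sets[OF random_point_measure B, of n]
    by (simp add: vimage_def Int_def conj_commute)
  interpret H: finite_measure_subalgebra M "history M Z n"
    using n by unfold_locales (auto intro: subalgebra_history)
  have one: "measure (offspring_law \<mu> \<zeta>) B = 1" if "\<zeta> \<in> A" for \<zeta>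
  proof -
    interpret P: prob_space "\<Pi>\<^sub>M p\<in>atoms \<zeta>. \<mu>"
      by (rule prob_space_PiM) (rule prob_space_reproduction_law)
    have meas: "superpose \<zeta> \<in> measurable (\<Pi>\<^sub>M p\<in>atoms \<zeta>. \<mu>) pm_space"
      by (rule measurable_superpose) (rule sets_reproduction_law)
    have "AE \<xi> in offspring_law \<mu> \<zeta>. \<xi> \<in> B"
      unfolding offspring_law_def
      using step[OF that] B by (subst AE_distr_iff[OF meas]) auto
    moreover have "prob_space (offspring_law \<mu> \<zeta>)"
      unfolding offspring_law_def by (rule P.prob_space_distr[OF meas])
    ultimately show ?thesis
      using B by (subst prob_space.prob_eq_1) (auto simp: offspring_law_def)
  qed
  have "prob ?E = (\<integral>\<omega>. indicator ?E \<omega> \<partial>M)"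
    using E by simp
  also have "\<dots> = (\<integral>\<omega>. real_cond_exp M (history M Z n) (indicator ?E) \<omega> \<partial>M)"
    using E by (intro H.real_cond_exp_int(2)[symmetric])
      (auto simp: integrable_indicator_iff emeasure_eq_measure)
  also have "\<dots> = (\<integral>\<omega>. 1 \<partial>M)"
  proof (rule integral_cong_AE)
    show "AE \<omega> in M. real_cond_exp M (history M Z n) (indicator ?E) \<omega> = 1"
      using branching[OF n B] prev by eventually_elim (simp add: one)
  qed (auto intro: borel_measurable_cond_exp2)
  also have "\<dots> = 1"
    by (simp add: prob_space)
  finally have "prob ?E = 1" .
  from AE_prob_1[OF this] show ?thesis by simp
qed

text \<open>The children of a particle at \<open>x\<close> have exponential moment at most
  \<open>K * exp (s * x)\<close>, so each generation costs one factor \<open>K\<close>.\<close>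

lemma AE_size_and_exp_moment:
  assumes "AE \<zeta> in \<mu>. real (size \<zeta>) = c \<and> (\<Sum>x\<in>#\<zeta>. exp (s * x)) \<le> K"
    and "0 \<le> K" and "1 \<le> n"
  shows "AE \<omega> in M. real (size (Z n \<omega>)) = c ^ n \<and> (\<Sum>x\<in>#Z n \<omega>. exp (s * x)) \<le> K ^ n"
  \<comment> \<open>The induction starts at 1, where the reproduction law applies directly; the
    branching property takes over from generation 2.\<close>
  using \<open>1 \<le> n\<close>
proof (induction n rule: dec_induct)
  case base
  show ?case
    using AE_distrD[OF random_point_measure assms(1)[unfolded reproduction_law]] by simp
next
  case (step n)
  define G where "G = (\<lambda>n. {\<zeta>. real (size \<zeta>) = c ^ n \<and> (\<Sum>x\<in>#\<zeta>. exp (s * x)) \<le> K ^ n})"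
  have "AE \<omega> in M. Z (Suc n) \<omega> \<in> G (Suc n)"
  proof (rule AE_next_generation)
    have "{\<zeta> \<in> space pm_space. real (size \<zeta>) = c ^ Suc n \<and> (\<Sum>x\<in>#\<zeta>. exp (s * x)) \<le> K ^ Suc n}
        \<in> sets pm_space"
      using measurable_size_pm_space measurable_sum_mset_pm_space[of "\<lambda>x. exp (s * x)"]
      by measurable
    then show "G (Suc n) \<in> sets pm_space"
      by (simp add: G_def)
    show "AE \<omega> in M. Z (Suc n - 1) \<omega> \<in> G n"
      using step.IH by (simp add: G_def)
    fix \<zeta> assume "\<zeta> \<in> G n"
    then have size: "real (size \<zeta>) = c ^ n" and mom: "(\<Sum>x\<in>#\<zeta>. exp (s * x)) \<le> K ^ n"
      by (auto simp: G_def)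
    \<comment> \<open>There are finitely many parents, so the exceptional null sets of the
      coordinates can be united.\<close>
    have "AE \<eta> in (\<Pi>\<^sub>M p\<in>atoms \<zeta>. \<mu>). \<forall>p\<in>atoms \<zeta>.
        real (size (\<eta> p)) = c \<and> (\<Sum>x\<in>#\<eta> p. exp (s * x)) \<le> K"
      using assms(1) prob_space_reproduction_law
      by (intro AE_finite_allI AE_PiM_component) auto
    then show "AE \<eta> in (\<Pi>\<^sub>M p\<in>atoms \<zeta>. \<mu>). superpose \<zeta> \<eta> \<in> G (Suc n)"
    proof eventually_elim
      case (elim \<eta>)
      have "real (size (superpose \<zeta> \<eta>)) = (\<Sum>p\<in>atoms \<zeta>. real (size (\<eta> p)))"
        using sum_mset_superpose[of "\<lambda>_. 1::real" \<zeta> \<eta>] by simp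
      also have "\<dots> = (\<Sum>p\<in>atoms \<zeta>. c)"
        using elim by simp
      also have "\<dots> = c ^ Suc n"
        using sum_atoms[of "\<lambda>_. c" \<zeta>] size by (simp add: mult.commute)
      finally have 1: "real (size (superpose \<zeta> \<eta>)) = c ^ Suc n" .
      have "(\<Sum>x\<in>#superpose \<zeta> \<eta>. exp (s * x))
          = (\<Sum>p\<in>atoms \<zeta>. exp (s * fst p) * (\<Sum>y\<in>#\<eta> p. exp (s * y)))"
        by (simp add: sum_mset_superpose sum_mset_distrib_left exp_add distrib_left mult.commute)
      also have "\<dots> \<le> (\<Sum>p\<in>atoms \<zeta>. exp (s * fst p) * K)"
        using elim by (intro sum_mono mult_left_mono) auto
      also have "\<dots> = (\<Sum>x\<in>#\<zeta>. exp (s * x)) * K"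
        using sum_atoms[of "\<lambda>x. exp (s * x)" \<zeta>] by (simp flip: sum_distrib_right)
      also have "\<dots> \<le> K ^ Suc n"
        using mult_right_mono[OF mom \<open>0 \<le> K\<close>] by (simp add: mult.commute)
      finally show ?case
        using 1 by (simp add: G_def)
    qed
  qed (use step.hyps in simp)
  then show ?case by (simp add: G_def)
qed

end

section \<open>Hoeffding's lemma and the Chernoff bound for point measures\<close>

lemma cosh_le_exp_square: "cosh x \<le> exp (x\<^sup>2 / 2)" for x :: real
proof -
  have "cosh y \<le> exp (y\<^sup>2 / 2)" if "0 \<le> y" for y :: real
  proof -
    have "exp (- (2 * y) * (1 / 2) + ln (1 + 1 / 2 * (exp (2 * y) - 1))) \<le> exp ((2 * y)\<^sup>2 / 8)"
      using Hoeffdings_lemma_aux[of "2 * y" "1 / 2"] that by simp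
    moreover have "1 + 1 / 2 * (exp (2 * y) - 1) = exp y * cosh y"
      by (simp add: cosh_def field_simps flip: exp_add)
    ultimately have "ln (cosh y) \<le> y\<^sup>2 / 2"
      by (simp add: ln_mult power_mult_distrib)
    then show ?thesis
      by (metis cosh_real_pos exp_le_cancel_iff exp_ln)
  qed
  from this[of "\<bar>x\<bar>"] show ?thesis by simp
qed

text \<open>By convexity the exponential lies below its chord over \<open>{-r..r}\<close>. The chord
  is split into a constant and a multiple of \<open>x\<close>, so that the latter cancels for
  centred point measures.\<close>

lemma exp_le_chord:
  fixes s x r :: real
  assumes "\<bar>x\<bar> \<le> r" and "0 < r"
  shows "exp (s * x) \<le> cosh (s * r) + x * (sinh (s * r) / r)"
proof -
  \<comment> \<open>The weight of the endpoint \<open>r\<close> when \<open>x\<close> is written as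
    a convex combination of \<open>-r\<close> and \<open>r\<close>.\<close>
  let ?u = "(r + x) / (2 * r)"
  have u: "0 \<le> ?u" "?u \<le> 1"
    using assms by (auto simp: field_simps)
  have "exp ((1 - ?u) *\<^sub>R (- (s * r)) + ?u *\<^sub>R (s * r))
      \<le> (1 - ?u) * exp (- (s * r)) + ?u * exp (s * r)"
    by (rule convex_onD[OF exp_convex]) (use u in auto)
  moreover have "(1 - ?u) *\<^sub>R (- (s * r)) + ?u *\<^sub>R (s * r) = s * x"
    using assms by (simp add: field_simps)
  moreover have "(1 - ?u) * exp (- (s * r)) + ?u * exp (s * r)
      = cosh (s * r) + x * (sinh (s * r) / r)"
    using assms by (simp add: cosh_def sinh_def field_simps)
  ultimately show ?thesis by simp
qed

lemma Hoeffdings_lemma_mset: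
  fixes \<zeta> :: "real multiset"
  assumes bounded: "set_mset \<zeta> \<subseteq> {-r..r}" and centred: "(\<Sum>x\<in>#\<zeta>. x) = 0"
  shows "(\<Sum>x\<in>#\<zeta>. exp (s * x)) \<le> size \<zeta> * exp (s\<^sup>2 * r\<^sup>2 / 2)"
proof (cases "0 < r")
  case True
  have "(\<Sum>x\<in>#\<zeta>. exp (s * x)) \<le> (\<Sum>x\<in>#\<zeta>. cosh (s * r) + x * (sinh (s * r) / r))"
    using bounded True by (intro sum_mset_mono exp_le_chord) (auto simp: abs_le_iff subset_iff minus_le_iff)
  \<comment> \<open>Centring removes the \<open>sinh\<close> term.\<close>
  also have "\<dots> = size \<zeta> * cosh (s * r)"
    using centred by (simp add: sum_mset.distrib flip: sum_mset_distrib_right times_divide_eq_right)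
  also have "\<dots> \<le> size \<zeta> * exp (s\<^sup>2 * r\<^sup>2 / 2)"
    using cosh_le_exp_square[of "s * r"] by (simp add: mult_left_mono power_mult_distrib)
  finally show ?thesis .
next
  case False
  \<comment> \<open>For \<open>r = 0\<close> all atoms are 0, and for negative \<open>r\<close>
    there are none; each exponential is then 1.\<close>
  then have zero: "x = 0" if "x \<in># \<zeta>" for x
    using bounded that by force
  have "(\<Sum>x\<in>#\<zeta>. exp (s * x)) \<le> (\<Sum>x\<in>#\<zeta>. exp (s\<^sup>2 * r\<^sup>2 / 2))"
    by (intro sum_mset_mono) (auto dest: zero)
  then show ?thesis by simp
qed

lemma Chernoff_bound_mset:
  fixes \<zeta> :: "real multiset"
  assumes "0 \<le> s"
    and "(\<Sum>x\<in>#\<zeta>. exp (s * x)) \<le> K" and "(\<Sum>x\<in>#\<zeta>. exp (- s * x)) \<le> K"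
  shows "(\<Sum>x\<in>#\<zeta>. indicator (- {-a..a}) x) \<le> 2 * K * exp (- (s * a))"
proof -
  \<comment> \<open>Outside the interval, one of the exponentials at \<open>s * x\<close> and
    \<open>- s * x\<close> is at least \<open>exp (s * a)\<close>. Using their sum treats both tails
    at once and yields the factor 2.\<close>
  have pointwise: "indicator (- {-a..a}) x \<le> exp (- (s * a)) * (exp (s * x) + exp (- s * x))"
    for x :: real
  proof (cases "x \<in> {-a..a}")
    case False
    then consider "a \<le> x" | "a \<le> - x" by fastforce
    then have "1 \<le> exp (s * x - s * a) + exp (- s * x - s * a)"
    proof cases
      case 1
      then have "1 \<le> exp (s * x - s * a)"
        using \<open>0 \<le> s\<close> by (simp add: mult_left_mono)
      then show ?thesis by (simp add: add_increasing2)
    next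
      case 2
      then have "1 \<le> exp (- s * x - s * a)"
        using mult_left_mono[OF 2 \<open>0 \<le> s\<close>] by simp
      then show ?thesis by (simp add: add_increasing)
    qed
    also have "\<dots> = exp (- (s * a)) * (exp (s * x) + exp (- s * x))"
      by (simp add: distrib_left flip: exp_add)
    finally show ?thesis using False by simp
  qed (simp add: add_nonneg_nonneg)
  have "(\<Sum>x\<in>#\<zeta>. indicator (- {-a..a}) x)
      \<le> (\<Sum>x\<in>#\<zeta>. exp (- (s * a)) * (exp (s * x) + exp (- s * x)))"
    by (intro sum_mset_mono pointwise)
  also have "\<dots> = exp (- (s * a)) * ((\<Sum>x\<in>#\<zeta>. exp (s * x)) + (\<Sum>x\<in>#\<zeta>. exp (- s * x)))"
    by (simp add: sum_mset.distrib flip: sum_mset_distrib_left)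
  also have "\<dots> \<le> exp (- (s * a)) * (K + K)"
    using assms by (intro mult_left_mono add_mono) auto
  finally show ?thesis by (simp add: mult_ac)
qed

section \<open>The degenerate case\<close>

lemma AE_eq_mean_if_ext_variance_0:
  assumes "ext_variance M X = 0" and "X \<in> borel_measurable M"
  shows "AE \<omega> in M. X \<omega> = (\<integral>\<omega>'. X \<omega>' \<partial>M)"
proof -
  have "AE \<omega> in M. ennreal ((X \<omega> - (\<integral>\<omega>'. X \<omega>' \<partial>M))\<^sup>2) = 0"
    using assms unfolding ext_variance_def by (subst nn_integral_0_iff_AE[symmetric]) auto
  then show ?thesis
    by eventually_elim (simp add: ennreal_eq_0_iff)
qed

text \<open>Both variances vanish, so the number of children and the sum of displacements are almost
  surely their means, the latter being 0 by \<open>A2\<close>. Hoeffding's lemma then applies to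
  each realisation. One \<open>c\<close> serves all \<open>s\<close>, as both tails are needed
  later.\<close>

lemma (in branching_random_walk) AE_reproduction_law_if_not_A5:
  assumes "A2 \<mu>" and "A4 \<mu> r" and "\<not> A5 \<mu>"
  shows "\<exists>c\<ge>0. \<forall>s. AE \<zeta> in \<mu>. real (size \<zeta>) = c \<and>
    (\<Sum>x\<in>#\<zeta>. exp (s * x)) \<le> c * exp (s\<^sup>2 * r\<^sup>2 / 2)"
proof (intro exI conjI allI)
  define c where "c = (\<integral>\<zeta>. mass (pm \<zeta>) \<partial>\<mu>)"
  show "0 \<le> c" by (simp add: c_def mass_def)
  obtain R where R: "R \<subseteq> {-r..r}" "AE \<zeta> in \<mu>. msupport (pm \<zeta>) \<subseteq> R"
    using \<open>A4 \<mu> r\<close> by (auto simp: A4_def)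
  have meas: "(\<lambda>\<zeta>. mass (pm \<zeta>)) \<in> borel_measurable \<mu>"
    unfolding measurable_cong_sets[OF sets_reproduction_law refl] mass_pm
    by (rule measurable_size_pm_space)
  have "AE \<zeta> in \<mu>. mass (pm \<zeta>) = c"
    unfolding c_def using \<open>\<not> A5 \<mu>\<close> meas
    by (intro AE_eq_mean_if_ext_variance_0) (auto simp: A5_def)
  \<comment> \<open>Measurability of the pairing comes from the integrability in
    \<open>A2\<close>.\<close>
  moreover have "AE \<zeta> in \<mu>. pairing (pm \<zeta>) (\<lambda>x. x) = (\<integral>\<zeta>. pairing (pm \<zeta>) (\<lambda>x. x) \<partial>\<mu>)"
    using assms by (intro AE_eq_mean_if_ext_variance_0) (auto simp: A5_def A2_def)
  moreover note R(2)
  ultimately show "AE \<zeta> in \<mu>. real (size \<zeta>) = c \<and>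
      (\<Sum>x\<in>#\<zeta>. exp (s * x)) \<le> c * exp (s\<^sup>2 * r\<^sup>2 / 2)" for s
  proof eventually_elim
    case (elim \<zeta>)
    have "set_mset \<zeta> \<subseteq> {-r..r}"
      using set_mset_subset_msupport[of \<zeta>] elim(3) R(1) by blast
    moreover have "(\<Sum>x\<in>#\<zeta>. x) = 0"
      using elim(2) \<open>A2 \<mu>\<close> by (simp add: A2_def pairing_pm)
    ultimately show ?case
      using Hoeffdings_lemma_mset[of \<zeta> r s] elim(1) by (simp add: mass_pm)
  qed
qed

theorem proposition1p5:
  fixes M :: "'a measure" and \<mu> :: "real multiset measure"
    and Z :: "nat \<Rightarrow> 'a \<Rightarrow> real multiset" and r0 :: real
  assumes "branching_random_walk M \<mu> Z"
    and "A1 \<mu>" and "A2 \<mu>" and "A3 \<mu>" and "A4 \<mu> r0" and "\<not> A5 \<mu>"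
  shows "\<forall>x>0. \<forall>n\<ge>1.
    measure M {\<omega> \<in> space M.
      measure (normalised (pm (Z n \<omega>))) (- {- sqrt (real n) * x .. sqrt (real n) * x})
        > 2 * exp (- x\<^sup>2 / (2 * r0\<^sup>2))} = 0"
proof (intro allI impI)
  fix x :: real and n :: nat
  assume "0 < x" and "1 \<le> n"
  interpret branching_random_walk M \<mu> Z by fact
  obtain c where "0 \<le> c" and c: "\<And>s. AE \<zeta> in \<mu>. real (size \<zeta>) = c \<and>
      (\<Sum>x\<in>#\<zeta>. exp (s * x)) \<le> c * exp (s\<^sup>2 * r0\<^sup>2 / 2)"
    using AE_reproduction_law_if_not_A5[OF \<open>A2 \<mu>\<close> \<open>A4 \<mu> r0\<close> \<open>\<not> A5 \<mu>\<close>] by blast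
  \<comment> \<open>The minimiser of the Chernoff exponent \<open>n s\<^sup>2 r0\<^sup>2 / 2 - s \<surd>n x\<close>; for \<open>r0 = 0\<close> it is junk,
    but then the exponents below vanish on both sides.\<close>
  define s where "s = x / (sqrt n * r0\<^sup>2)"
  let ?K = "c * exp (s\<^sup>2 * r0\<^sup>2 / 2)" and ?a = "sqrt n * x"
  let ?p = "\<lambda>\<omega>. measure (normalised (pm (Z n \<omega>))) (- {- sqrt (real n) * x .. sqrt (real n) * x})"
  have "0 \<le> s"
    using \<open>0 < x\<close> by (simp add: s_def)
  have exponent: "n * (s\<^sup>2 * r0\<^sup>2 / 2) - s * ?a = - x\<^sup>2 / (2 * r0\<^sup>2)"
    using \<open>1 \<le> n\<close> by (cases "r0 = 0")
      (simp_all add: s_def power_divide power_mult_distrib field_simps power2_eq_square)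
  have "AE \<omega> in M. real (size (Z n \<omega>)) = c ^ n \<and> (\<Sum>x\<in>#Z n \<omega>. exp (s * x)) \<le> ?K ^ n"
    by (rule AE_size_and_exp_moment[OF c]) (use \<open>0 \<le> c\<close> \<open>1 \<le> n\<close> in auto)
  moreover have "AE \<omega> in M. real (size (Z n \<omega>)) = c ^ n \<and>
      (\<Sum>x\<in>#Z n \<omega>. exp (- s * x)) \<le> (c * exp ((- s)\<^sup>2 * r0\<^sup>2 / 2)) ^ n"
    by (rule AE_size_and_exp_moment[OF c]) (use \<open>0 \<le> c\<close> \<open>1 \<le> n\<close> in auto)
  ultimately have "AE \<omega> in M. \<not> ?p \<omega> > 2 * exp (- x\<^sup>2 / (2 * r0\<^sup>2))"
  proof eventually_elim
    case (elim \<omega>)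
    have "(\<Sum>y\<in>#Z n \<omega>. indicator (- {- ?a..?a}) y) \<le> 2 * ?K ^ n * exp (- (s * ?a))"
      using elim \<open>0 \<le> s\<close> by (intro Chernoff_bound_mset) auto
    \<comment> \<open>The factor \<open>c ^ n\<close> in \<open>?K ^ n\<close> is exactly the
      population size, which normalisation cancels.\<close>
    also have "\<dots> = 2 * exp (n * (s\<^sup>2 * r0\<^sup>2 / 2) - s * ?a) * size (Z n \<omega>)"
      using elim
      by (simp only: power_mult_distrib exp_of_nat_mult[symmetric] diff_conv_add_uminus exp_add mult_ac)
    also note exponent
    finally have "(\<Sum>y\<in>#Z n \<omega>. indicator (- {- ?a..?a}) y)
        \<le> 2 * exp (- x\<^sup>2 / (2 * r0\<^sup>2)) * size (Z n \<omega>)" .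
    then have "?p \<omega> \<le> 2 * exp (- x\<^sup>2 / (2 * r0\<^sup>2))"
      \<comment> \<open>For an empty generation the quotient is 0 by the convention on division by
        0.\<close>
      by (cases "size (Z n \<omega>) = 0")
        (auto simp: measure_normalised_pm pos_divide_le_eq nonempty_has_size[symmetric])
    then show ?case by simp
  qed
  then show "measure M {\<omega> \<in> space M. ?p \<omega> > 2 * exp (- x\<^sup>2 / (2 * r0\<^sup>2))} = 0"
    \<comment> \<open>A non-measurable set has \<open>measure\<close> 0 by convention, so both cases
      give 0.\<close>
    by (cases "{\<omega> \<in> space M. ?p \<omega> > 2 * exp (- x\<^sup>2 / (2 * r0\<^sup>2))} \<in> sets M")
      (simp_all only: prob_Collect_eq_0 measure_notin_sets not_False_eq_True)
qed

end
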